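(* Let $s\in\mathbb{R}_{>0}$ and $v=(0,\ldots,0,1)\in\mathbb{R}^{d+1}$. Let $x,y\in\mathbb{R}^d$ and $\hat{x}=S(x,v,s)$, $\hat{y}=S(y,v,s)$. Then the following equations hold: $$\langle\hat{x},\hat{y}\rangle=1-2s^2\frac{\langle x,x\rangle-2\langle x,y\rangle+\langle y,y\rangle}{(\langle x,x\rangle+s^2)(\langle y,y\rangle+s^2)}=1-\frac{2s^2\|x-y\|^2}{(\|x\|^2+s^2)(\|y\|^2+s^2)},$$ $$\|\hat{x}-\hat{y}\|^2=\frac{4s^2\|x-y\|^2}{(\|x\|^2+s^2)(\|y\|^2+s^2)},$$ $$\langle x,y\rangle=s^2\frac{\langle\hat{x},\hat{y}\rangle-\hat{x}_{d+1}\hat{y}_{d+1}}{(1+\hat{x}_{d+1})(1+\hat{y}_{d+1})}=s^2\frac{\langle\hat{x},\hat{y}\rangle-\langle\hat{x},v\rangle\langle\hat{y},v\rangle}{(1+\langle\hat{x},v\rangle)(1+\langle\hat{y},v\rangle)},$$ $$\|x-y\|^2=\frac{s^2}{(1+\hat{x}_{d+1})(1+\hat{y}_{d+1})}\|\hat{x}-\hat{y}\|^2=\frac{4s^2}{(4-\|\hat{x}-v\|^2)(4-\|\hat{y}-v\|^2)}\|\hat{x}-\hat{y}\|^2.$$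
   Context: $\|\cdot\|$ is the Euclidean norm and $\langle\cdot,\cdot\rangle$ the standard inner product; $z_{d+1}$ denotes the last coordinate of $z\in\mathbb{R}^{d+1}$. For $v=(0,\ldots,0,1)\in\mathbb{R}^{d+1}$ and $s>0$, the spherical embedding of $x\in\mathbb{R}^d$ is $$S(x,v,s)=2s\,\frac{[x,s]}{\|x\|^2+s^2}-v\in\mathbb{R}^{d+1},$$ where $[x,s]\in\mathbb{R}^{d+1}$ is $x$ extended by the last coordinate $s$. *)

theory Defs
  imports "HOL-Analysis.Analysis"
begin

text \<open>
  Euclidean space of dimension \<open>d = CARD('n)\<close> is \<open>real ^ 'n\<close>; dimension \<open>d + 1\<close> is
  \<open>real ^ ('n option)\<close>, where \<open>None\<close> indexes the last coordinate.
\<close>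

definition extend_vec :: "real ^ 'n \<Rightarrow> real \<Rightarrow> real ^ ('n::finite) option" where
  "extend_vec x t = (\<chi> i. case i of None \<Rightarrow> t | Some j \<Rightarrow> x $ j)"

definition last_coord :: "real ^ ('n::finite) option \<Rightarrow> real" where
  "last_coord z = z $ None"

definition spherical_embedding ::
    "real ^ 'n \<Rightarrow> real ^ ('n::finite) option \<Rightarrow> real \<Rightarrow> real ^ 'n option" where
  "spherical_embedding x v s =
     (2 * s) *\<^sub>R (extend_vec x s /\<^sub>R ((norm x)\<^sup>2 + s\<^sup>2)) - v"

end

theory Submission
  imports Defs
begin

text \<open>
  Since \<open>1 + \<langle>S(x), v\<rangle> = 2 s\<^sup>2 / (\<parallel>x\<parallel>\<^sup>2 + s\<^sup>2)\<close>, the inner product of two embedded points is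
  obtained by expanding bilinearly. In particular embedded points are unit vectors, so that
  \<open>\<parallel>S(x) - S(y)\<parallel>\<^sup>2 = 2 - 2 \<langle>S(x), S(y)\<rangle>\<close> and \<open>4 - \<parallel>S(x) - v\<parallel>\<^sup>2 = 2 (1 + \<langle>S(x), v\<rangle>)\<close>, and the
  inverse formulas are algebra.
\<close>

text \<open>The sum over \<open>'n option\<close> splits into the \<open>None\<close> term and a sum
  over the range of \<open>Some\<close>, which reindexes to \<open>'n\<close>.\<close>

lemma inner_extend_vec: "extend_vec x a \<bullet> extend_vec y b = x \<bullet> y + a * b"
  by (simp add: extend_vec_def inner_vec_def UNIV_option_conv sum.reindex)

lemma norm_power2_add_pos:
  fixes x :: "'a::real_normed_vector" and s :: real
  assumes "s > 0"
  shows "(norm x)\<^sup>2 + s\<^sup>2 > 0"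
  using assms by (simp add: add_nonneg_pos)

text \<open>Links the two forms of the inverse formulas, since the pole \<open>v\<close> is
  \<open>extend_vec 0 1\<close>.\<close>

lemma inner_extend_vec_0_1: "z \<bullet> extend_vec 0 1 = last_coord z"
  by (simp add: extend_vec_def last_coord_def inner_vec_def UNIV_option_conv sum.reindex)

lemma last_coord_spherical_embedding:
  "last_coord (spherical_embedding x (extend_vec 0 1) s) = 2 * s\<^sup>2 / ((norm x)\<^sup>2 + s\<^sup>2) - 1"
  by (simp add: last_coord_def spherical_embedding_def extend_vec_def power2_eq_square
      divide_inverse mult_ac)

lemma inner_spherical_embedding:
  assumes "s > 0"
  shows "spherical_embedding x (extend_vec 0 1) s \<bullet> spherical_embedding y (extend_vec 0 1) s
    = 1 - 2 * s\<^sup>2 * (norm (x - y))\<^sup>2 / (((norm x)\<^sup>2 + s\<^sup>2) * ((norm y)\<^sup>2 + s\<^sup>2))"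
proof -
  define a where "a = (norm x)\<^sup>2 + s\<^sup>2"
  define b where "b = (norm y)\<^sup>2 + s\<^sup>2"
  have pos: "a > 0" "b > 0"
    using norm_power2_add_pos[OF assms] by (simp_all add: a_def b_def)
  \<comment> \<open>Written this way, the claim becomes a rational identity in \<open>a\<close>,
    \<open>b\<close>, \<open>s\<close> and \<open>x \<bullet> y\<close>.\<close>
  have dist: "(norm (x - y))\<^sup>2 = a + b - 2 * s\<^sup>2 - 2 * (x \<bullet> y)"
    by (simp add: a_def b_def power2_norm_eq_inner inner_diff_left inner_diff_right inner_commute)
  \<comment> \<open>Each cross term with the pole contributes a factor \<open>s\<close>, and the
    pole with itself gives 1. As squares are rewritten to products here, \<open>a\<close> and
    \<open>b\<close> are folded back in product form.\<close>
  have "spherical_embedding x (extend_vec 0 1) s \<bullet> spherical_embedding y (extend_vec 0 1) s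
    = (2 * s / a) * (2 * s / b) * (x \<bullet> y + s\<^sup>2) - (2 * s / a) * s - (2 * s / b) * s + 1"
    by (simp add: spherical_embedding_def inner_diff_left inner_diff_right inner_extend_vec
        divide_inverse power2_eq_square
        flip: a_def[unfolded power2_eq_square] b_def[unfolded power2_eq_square])
      (simp add: algebra_simps)
  also have "\<dots> = 1 - 2 * s\<^sup>2 * (a + b - 2 * s\<^sup>2 - 2 * (x \<bullet> y)) / (a * b)"
    using pos by (simp add: field_simps power2_eq_square)
  finally show ?thesis
    by (simp add: dist flip: a_def b_def)
qed

theorem corollary4:
  fixes s :: real
    and x y :: "real ^ 'n"
    and v xh yh :: "real ^ ('n::finite) option"
  assumes "s > 0"
    and "v = extend_vec 0 1"
    and "xh = spherical_embedding x v s"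
    and "yh = spherical_embedding y v s"
  shows
    "(xh \<bullet> yh
        = 1 - 2 * s\<^sup>2 * ((x \<bullet> x - 2 * (x \<bullet> y) + y \<bullet> y) / ((x \<bullet> x + s\<^sup>2) * (y \<bullet> y + s\<^sup>2)))
      \<and> 1 - 2 * s\<^sup>2 * ((x \<bullet> x - 2 * (x \<bullet> y) + y \<bullet> y) / ((x \<bullet> x + s\<^sup>2) * (y \<bullet> y + s\<^sup>2)))
        = 1 - (2 * s\<^sup>2 * (norm (x - y))\<^sup>2) / (((norm x)\<^sup>2 + s\<^sup>2) * ((norm y)\<^sup>2 + s\<^sup>2)))
     \<and> (norm (xh - yh))\<^sup>2
        = (4 * s\<^sup>2 * (norm (x - y))\<^sup>2) / (((norm x)\<^sup>2 + s\<^sup>2) * ((norm y)\<^sup>2 + s\<^sup>2))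
     \<and> (x \<bullet> y
        = s\<^sup>2 * ((xh \<bullet> yh - last_coord xh * last_coord yh)
                 / ((1 + last_coord xh) * (1 + last_coord yh)))
      \<and> s\<^sup>2 * ((xh \<bullet> yh - last_coord xh * last_coord yh)
                 / ((1 + last_coord xh) * (1 + last_coord yh)))
        = s\<^sup>2 * ((xh \<bullet> yh - (xh \<bullet> v) * (yh \<bullet> v)) / ((1 + xh \<bullet> v) * (1 + yh \<bullet> v))))
     \<and> ((norm (x - y))\<^sup>2
        = s\<^sup>2 / ((1 + last_coord xh) * (1 + last_coord yh)) * (norm (xh - yh))\<^sup>2
      \<and> s\<^sup>2 / ((1 + last_coord xh) * (1 + last_coord yh)) * (norm (xh - yh))\<^sup>2
        = (4 * s\<^sup>2) / ((4 - (norm (xh - v))\<^sup>2) * (4 - (norm (yh - v))\<^sup>2)) * (norm (xh - yh))\<^sup>2)"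
proof -
  define a where "a = (norm x)\<^sup>2 + s\<^sup>2"
  define b where "b = (norm y)\<^sup>2 + s\<^sup>2"
  define D where "D = (norm (x - y))\<^sup>2"
  have pos: "a > 0" "b > 0"
    using norm_power2_add_pos[OF assms(1)] by (simp_all add: a_def b_def)
  have D_eq: "D = x \<bullet> x - 2 * (x \<bullet> y) + y \<bullet> y"
    by (simp add: D_def power2_norm_eq_inner inner_diff_left inner_diff_right inner_commute)
  have a_eq: "a = x \<bullet> x + s\<^sup>2" and b_eq: "b = y \<bullet> y + s\<^sup>2"
    by (simp_all add: a_def b_def power2_norm_eq_inner)
  have inner_xyh: "xh \<bullet> yh = 1 - 2 * s\<^sup>2 * D / (a * b)"
    using inner_spherical_embedding[OF assms(1), of x y] assms by (simp add: a_def b_def D_def)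
  \<comment> \<open>For equal arguments the distance in the numerator is 0.\<close>
  have unit: "xh \<bullet> xh = 1" "yh \<bullet> yh = 1"
    using inner_spherical_embedding[OF assms(1), of x x]
      inner_spherical_embedding[OF assms(1), of y y] assms by simp_all
  have unit_v: "v \<bullet> v = 1"
    by (simp add: assms inner_extend_vec)
  have inner_v: "xh \<bullet> v = last_coord xh" "yh \<bullet> v = last_coord yh"
    by (simp_all add: assms inner_extend_vec_0_1)
  have last: "last_coord xh = 2 * s\<^sup>2 / a - 1" "last_coord yh = 2 * s\<^sup>2 / b - 1"
    by (simp_all add: assms last_coord_spherical_embedding a_def b_def)
  have dist: "(norm (xh - yh))\<^sup>2 = 4 * s\<^sup>2 * D / (a * b)"
    using inner_xyh unit
    by (simp add: power2_norm_eq_inner inner_diff_left inner_diff_right inner_commute[of yh xh])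
  have dist_v: "4 - (norm (xh - v))\<^sup>2 = 2 * (1 + last_coord xh)"
    "4 - (norm (yh - v))\<^sup>2 = 2 * (1 + last_coord yh)"
    using unit unit_v inner_v
    by (simp_all add: power2_norm_eq_inner inner_diff_left inner_diff_right inner_commute[of v xh] inner_commute[of v yh])
  have "xh \<bullet> yh - last_coord xh * last_coord yh
    = 2 * s\<^sup>2 / a + 2 * s\<^sup>2 / b - (2 * s\<^sup>2 / a) * (2 * s\<^sup>2 / b) - 2 * s\<^sup>2 * D / (a * b)"
    by (simp add: inner_xyh last algebra_simps)
  also have "\<dots> = 2 * s\<^sup>2 * (a + b - 2 * s\<^sup>2 - D) / (a * b)"
    using pos by (simp add: field_simps)
  \<comment> \<open>Polarization: \<open>a + b - 2 * s\<^sup>2\<close> is the sum of the squared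
    norms of \<open>x\<close> and \<open>y\<close>.\<close>
  also have "a + b - 2 * s\<^sup>2 - D = 2 * (x \<bullet> y)"
    by (simp add: a_eq b_eq D_eq)
  finally have num: "xh \<bullet> yh - last_coord xh * last_coord yh = 4 * s\<^sup>2 * (x \<bullet> y) / (a * b)"
    by simp
  \<comment> \<open>This shares the denominator \<open>a * b\<close> with \<open>num\<close> and
    \<open>dist\<close>, so it cancels in both quotients below.\<close>
  have den: "(1 + last_coord xh) * (1 + last_coord yh) = 4 * s\<^sup>2 * s\<^sup>2 / (a * b)"
    by (simp add: last)
  have inner_xy: "x \<bullet> y = s\<^sup>2 * ((xh \<bullet> yh - last_coord xh * last_coord yh)
      / ((1 + last_coord xh) * (1 + last_coord yh)))"
    unfolding num den using pos assms(1) by simp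
  have dist_xy: "D = s\<^sup>2 / ((1 + last_coord xh) * (1 + last_coord yh)) * (norm (xh - yh))\<^sup>2"
    unfolding dist den using pos assms(1) by simp
  have den_v: "4 * s\<^sup>2 / ((4 - (norm (xh - v))\<^sup>2) * (4 - (norm (yh - v))\<^sup>2))
      = s\<^sup>2 / ((1 + last_coord xh) * (1 + last_coord yh))"
  proof -
    \<comment> \<open>The 4 absorbs the factor 2 from each half of \<open>dist_v\<close>. Division
      by zero being 0, the identity holds for all reals.\<close>
    have "4 * r / (2 * p * (2 * q)) = r / (p * q)" for p q r :: real
      by simp
    then show ?thesis
      unfolding dist_v .
  qed
  show ?thesis
    \<comment> \<open>Once \<open>v\<close> is eliminated and \<open>a\<close>, \<open>b\<close>,
      \<open>D\<close> are folded in, the second equations of both inverse formulas are reflexive.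
      The equations for \<open>xh \<bullet> yh\<close> then differ from \<open>inner_xyh\<close>
      only in how products and fractions are grouped.\<close>
    unfolding inner_v den_v a_def[symmetric] b_def[symmetric] D_def[symmetric]
      a_eq[symmetric] b_eq[symmetric] D_eq[symmetric]
    by (intro conjI inner_xy dist dist_xy refl) (simp_all add: inner_xyh)
qed

end
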